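(* Let $n>0$ be an integer. Then the gap $2n$ occurs infinitely often in the stages of Eratosthenes sieve, i.e. there are infinitely many primes $p$ such that $2n$ occurs as a gap in the cycle $\mathcal{G}(p^\#)$. Moreover, the ratio $w_{2n,1}(p^\#)=n_{2n,1}(p^\#)/n_{2,1}(p^\#)$ of the number of gaps equal to $2n$ to the number of gaps equal to $2$ in $\mathcal{G}(p^\#)$ converges as $p\to\infty$ through the primes, with limit $$ w_{2n,1}(\infty) := \lim_{p\to\infty} w_{2n,1}(p^\#) = \prod_{q>2,\ q\mid n} \frac{q-1}{q-2},$$ where the product is over the odd primes $q$ dividing $n$.
   Context: For a prime $p$, the primorial $p^\#$ is the product of all primes $\le p$. For an integer $N\ge 2$, a generator of $\mathbb{Z} \bmod N$ is a residue class coprime to $N$. The cycle of gaps $\mathcal{G}(N)=g_1 g_2\cdots g_{\phi(N)}$ is the cyclic sequence of differences between consecutive positive integers coprime to $N$, over one period of length $N$, where $g_1$ is the difference between $1$ and the next larger integer coprime to $N$; thus $g_1+\dots+g_{\phi(N)}=N$. The cycle $\mathcal{G}(p^\#)$ is the stage of Eratosthenes sieve for the prime $p$. $n_{g,1}(N)$ denotes the number of indices $i\in\{1,\dots,\phi(N)\}$ with $g_i=g$. *)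

theory Defs
  imports Complex_Main "HOL-Library.Infinite_Set" "HOL-Number_Theory.Number_Theory"
begin

definition primorial :: "nat \<Rightarrow> nat" where
  "primorial p = \<Prod>{q. prime q \<and> q \<le> p}"

text \<open>
  The increasing enumeration of the positive integers coprime to \<open>N\<close>. Since \<^const>\<open>enumerate\<close>
  counts from \<open>0\<close>, we have \<open>coprime_seq N 0 = 1\<close>.
\<close>

definition coprime_seq :: "nat \<Rightarrow> nat \<Rightarrow> nat" where
  "coprime_seq N = enumerate {m. 0 < m \<and> coprime m N}"

text \<open>
  The gap \<open>g\<^sub>i\<close>, for \<open>i \<ge> 1\<close>. The truncated subtraction on \<^typ>\<open>nat\<close> is harmless,
  as \<open>coprime_seq N\<close> is increasing for \<open>N > 0\<close>.
\<close>

definition gap :: "nat \<Rightarrow> nat \<Rightarrow> nat" where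
  "gap N i = coprime_seq N i - coprime_seq N (i - 1)"

text \<open>
  The cycle is represented by one period, as the list of gaps starting with the gap from \<open>1\<close>
  to the next larger integer coprime to \<open>N\<close>; for \<open>N \<ge> 2\<close> its last entry is the gap from \<open>N - 1\<close> to \<open>N + 1\<close>.
\<close>

definition gap_cycle :: "nat \<Rightarrow> nat list" where
  "gap_cycle N = map (gap N) [1..<totient N + 1]"

definition gap_count :: "nat \<Rightarrow> nat \<Rightarrow> nat" where
  "gap_count g N = card {i \<in> {1..totient N}. gap N i = g}"

definition gap_ratio :: "nat \<Rightarrow> nat \<Rightarrow> real" where
  "gap_ratio g N = real (gap_count g N) / real (gap_count 2 N)"

text \<open>The filter for limits as \<open>p\<close> tends to infinity through the primes.\<close>

definition primes_at_top :: "nat filter" where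
  "primes_at_top = inf at_top (principal {p. prime p})"

end

theory Submission
  imports Defs "HOL-Analysis.Harmonic_Numbers"
begin

text \<open>
  A gap \<open>g\<close> of the cycle corresponds to a residue \<open>a\<close> such that \<open>a\<close> and \<open>a + g\<close> are coprime to the
  primorial but no \<open>a + j\<close> with \<open>0 < j < g\<close> is. By the Chinese remainder theorem the number of
  residues for which all \<open>a + h\<close>, \<open>h \<in> H\<close>, are coprime to the primorial is the product of
  \<open>q - \<nu>\<^sub>q(H)\<close>, where \<open>\<nu>\<^sub>q(H)\<close> counts the residues that \<open>H\<close> occupies modulo \<open>q\<close>. For \<open>H = {0, 2n}\<close>
  and \<open>H = {0, 2}\<close> the factors agree unless an odd \<open>q\<close> divides \<open>n\<close>, which gives the limit as
  the ratio of these two products. The residues to be discarded are covered by the patterns \<open>{0, j, 2n}\<close>,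
  which have factors \<open>q - 3\<close> for all \<open>q > 2n\<close>; relative to \<open>{0, 2}\<close> they are negligible because
  the product of \<open>1 - 1/q\<close> over the primes tends to \<open>0\<close>. As the limit is positive, the gap \<open>2n\<close>
  occurs at every late stage.
\<close>

section \<open>Counting residues by the Chinese remainder theorem\<close>

text \<open>The shifts \<open>a + h\<close> are not reduced modulo \<open>N\<close> and may pass
  \<open>N\<close>; coprimality depends only on the residue class, so \<open>a\<close> ranges over
  one full residue system.\<close>

definition pattern :: "nat set \<Rightarrow> nat \<Rightarrow> nat set" where
  "pattern H N = {a \<in> {..<N}. \<forall>h\<in>H. coprime (a + h) N}"

lemma finite_pattern [simp]: "finite (pattern H N)"
  by (simp add: pattern_def)

lemma coprime_mod_add_left_iff:
  fixes a h M :: nat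
  assumes "M > 0"
  shows "coprime (a mod M + h) M \<longleftrightarrow> coprime (a + h) M"
  by (metis assms coprime_mod_left_iff mod_add_left_eq neq0_conv)

text \<open>Reduction modulo both factors is a bijection by the Chinese remainder theorem, and
  coprimality to \<open>M * N\<close> is tested on each factor separately.\<close>

lemma card_pattern_mult:
  assumes "coprime M N" "M > 0" "N > 0"
  shows "card (pattern H (M * N)) = card (pattern H M) * card (pattern H N)"
proof -
  have "bij_betw (\<lambda>a. (a mod M, a mod N)) (pattern H (M * N)) (pattern H M \<times> pattern H N)"
    unfolding bij_betw_def
  proof
    show "inj_on (\<lambda>a. (a mod M, a mod N)) (pattern H (M * N))"
    proof (rule inj_onI)
      fix x y assume xy: "x \<in> pattern H (M * N)" "y \<in> pattern H (M * N)"
        "(x mod M, x mod N) = (y mod M, y mod N)"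
      then have "[x = y] (mod M * N)"
        using assms(1) by (intro coprime_cong_mult_nat) (auto simp: cong_def)
      then show "x = y"
        using xy by (auto simp: pattern_def intro: cong_less_modulus_unique_nat)
    qed
    show "(\<lambda>a. (a mod M, a mod N)) ` pattern H (M * N) = pattern H M \<times> pattern H N"
    proof (intro equalityI subsetI)
      fix z assume "z \<in> (\<lambda>a. (a mod M, a mod N)) ` pattern H (M * N)"
      then show "z \<in> pattern H M \<times> pattern H N"
        using assms by (auto simp: pattern_def coprime_mod_add_left_iff)
    next
      fix z assume z: "z \<in> pattern H M \<times> pattern H N"
      obtain b c where bc: "z = (b, c)" by (cases z)
      have bc': "b \<in> pattern H M" "c \<in> pattern H N" using z bc by auto
      obtain a where a: "a < M * N" "[a = b] (mod M)" "[a = c] (mod N)"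
        using binary_chinese_remainder_unique_nat[of M N b c] assms by auto
      have m: "a mod M = b" "a mod N = c"
        using a bc' by (auto simp: pattern_def cong_def)
      have "a \<in> pattern H (M * N)"
        using a(1) bc' assms coprime_mod_add_left_iff[of M a] coprime_mod_add_left_iff[of N a] m
        by (auto simp: pattern_def)
      then show "z \<in> (\<lambda>a. (a mod M, a mod N)) ` pattern H (M * N)"
        using m bc by force
    qed
  qed
  then show ?thesis
    by (metis bij_betw_same_card card_cartesian_product)
qed

lemma card_pattern_prod:
  assumes "finite S" "\<And>q. q \<in> S \<Longrightarrow> prime q"
  shows "card (pattern H (\<Prod>S)) = (\<Prod>q\<in>S. card (pattern H q))"
  using assms
proof (induction S rule: finite_induct)
  case empty
  have "pattern H 1 = {0}"
    by (auto simp: pattern_def)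
  then show ?case by simp
next
  case (insert q S)
  have "coprime q (\<Prod>S)"
    using insert by (intro prod_coprime_right) (metis insertCI primes_coprime)
  moreover have "\<Prod>S > 0"
    using insert by (intro prod_pos) (auto intro: prime_gt_0_nat)
  ultimately show ?case
    using insert by (simp add: card_pattern_mult prime_gt_0_nat)
qed

text \<open>The discarded residues are the negatives of those occupied by \<open>H\<close>, and
  negation modulo \<open>q\<close> is injective.\<close>

lemma card_pattern_prime:
  assumes "prime q"
  shows "card (pattern H q) = q - card ((\<lambda>h. h mod q) ` H)"
proof -
  have q: "q > 1" using assms by (rule prime_gt_1_nat)
  let ?R = "(\<lambda>h. h mod q) ` H"
  \<comment> \<open>Negation modulo \<open>q\<close>; the outer \<open>mod\<close> sends
    \<open>0\<close> to \<open>0\<close> rather than to \<open>q\<close>.\<close>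
  let ?f = "\<lambda>r. (q - r) mod q"
  have R: "?R \<subseteq> {..<q}" using q by auto
  have f: "?f r = (if r = 0 then 0 else q - r)" if "r < q" for r
    using that by auto
  have hit: "q dvd a + h \<longleftrightarrow> a = ?f (h mod q)" if "a < q" for a h
  proof -
    have "q dvd a + h \<longleftrightarrow> q dvd a + h mod q"
      by (metis mod_add_right_eq mod_eq_0_iff_dvd)
    also have "\<dots> \<longleftrightarrow> a = ?f (h mod q)"
    proof -
      have r: "h mod q < q" using q by simp
      have "a + h mod q < 2 * q" using that r by linarith
      then have "q dvd a + h mod q \<longleftrightarrow> a + h mod q = 0 \<or> a + h mod q = q"
        using q by (auto elim!: dvdE simp: less_2_cases_iff)
      also have "\<dots> \<longleftrightarrow> a = ?f (h mod q)"
        unfolding f[OF r] using that r by auto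
      finally show ?thesis .
    qed
    finally show ?thesis .
  qed
  have "pattern H q = {..<q} - ?f ` ?R"
    using hit assms prime_imp_coprime_nat[OF assms]
    by (auto simp: pattern_def coprime_commute[of _ q] coprime_absorb_left q image_iff
      prime_nat_iff) 
  moreover have "inj_on ?f ?R"
  proof (rule inj_onI)
    fix r s assume rs: "r \<in> ?R" "s \<in> ?R" "?f r = ?f s"
    then have "r < q" "s < q" using R by blast+
    with rs(3) show "r = s"
      unfolding f[OF \<open>r < q\<close>] f[OF \<open>s < q\<close>] by (simp split: if_splits)
  qed
  moreover have "?f ` ?R \<subseteq> {..<q}" using q by auto
  ultimately show ?thesis
    by (simp add: card_Diff_subset finite_subset card_image)
qed

lemma even_primorial:
  assumes "p \<ge> 2"
  shows "even (primorial p)"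
  unfolding primorial_def using assms by (intro dvd_prodI[of _ 2 "\<lambda>q. q", simplified]) auto

lemma primorial_gt_1:
  assumes "p \<ge> 2"
  shows "primorial p > 1"
proof -
  have "2 dvd primorial p"
    using assms by (rule even_primorial)
  moreover have "primorial p > 0"
    unfolding primorial_def by (intro prod_pos) (auto intro: prime_gt_0_nat)
  ultimately show ?thesis
    using dvd_imp_le by fastforce
qed

lemma card_pattern_primorial:
  "card (pattern H (primorial p)) =
     (\<Prod>q | prime q \<and> q \<le> p. q - card ((\<lambda>h. h mod q) ` H))"
  unfolding primorial_def by (subst card_pattern_prod) (auto simp: card_pattern_prime)

section \<open>Gaps as patterns of residues\<close>

text \<open>The next enumerated element is the least element of \<open>S\<close> beyond
  \<open>a i\<close>. For \<open>g = 0\<close> the right side would always hold and the left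
  never.\<close>

lemma enumerate_diff_eq_iff:
  fixes S :: "nat set"
  assumes S: "infinite S" and g: "g > 0"
  defines "a \<equiv> \<lambda>i. enumerate S i"
  shows "a (Suc i) - a i = g \<longleftrightarrow> a i + g \<in> S \<and> (\<forall>j\<in>{0<..<g}. a i + j \<notin> S)"
proof -
  have less: "a i < a (Suc i)" and mem: "a (Suc i) \<in> S"
    using S by (auto simp: a_def enumerate_in_set)
  have least: "a (Suc i) \<le> s" if "s \<in> S" "a i < s" for s
    using that S unfolding a_def by (simp add: enumerate_Suc'' Least_le)
  show ?thesis
  proof
    assume eq: "a (Suc i) - a i = g"
    then have "a (Suc i) = a i + g" using less by simp
    then show "a i + g \<in> S \<and> (\<forall>j\<in>{0<..<g}. a i + j \<notin> S)"
      using mem least by fastforce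
  next
    assume A: "a i + g \<in> S \<and> (\<forall>j\<in>{0<..<g}. a i + j \<notin> S)"
    then have "a (Suc i) \<le> a i + g" using least g by simp
    moreover have "\<not> a (Suc i) - a i < g"
      using A less mem by (metis add_diff_inverse_nat greaterThanLessThan_iff not_less_iff_gr_or_eq zero_less_diff)
    ultimately show "a (Suc i) - a i = g" by simp
  qed
qed

text \<open>The indices with value at most \<open>N\<close> form a finite downward closed set, hence
  an initial segment, whose length is found by injectivity.\<close>

lemma enumerate_image_initial_segment:
  fixes S :: "nat set"
  assumes S: "infinite S"
  shows "enumerate S ` {..<card {k \<in> S. k \<le> N}} = {k \<in> S. k \<le> N}"
proof -
  let ?I = "{i. enumerate S i \<le> N}"
  have img: "enumerate S ` ?I = {k \<in> S. k \<le> N}"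
    using enumerate_Ex[OF S] enumerate_in_set[OF S] by force
  have inj: "inj_on (enumerate S) ?I"
    using inj_enumerate[OF S] by (rule inj_on_subset) simp
  have card: "card ?I = card {k \<in> S. k \<le> N}"
    using card_image[OF inj] img by simp
  have fin: "finite ?I"
    using img inj by (metis (no_types, lifting) finite_imageD finite_nat_set_iff_bounded_le mem_Collect_eq)
  have down: "j \<in> ?I" if "i \<in> ?I" "j \<le> i" for i j
    using that S by (auto intro: order.trans[of _ "enumerate S i"])
  have "?I = {..<card ?I}"
  proof (rule card_subset_eq[symmetric])
    show "finite ?I" by (fact fin)
    show "{..<card ?I} \<subseteq> ?I"
    proof
      fix i assume i: "i \<in> {..<card ?I}"
      show "i \<in> ?I"
      proof (rule ccontr)
        assume "i \<notin> ?I"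
        then have "?I \<subseteq> {..<i}" using down by (meson lessThan_iff not_le subsetI)
        then have "card ?I \<le> i" using card_mono[of "{..<i}" ?I] by simp
        with i show False by simp
      qed
    qed
  qed simp
  with img card show ?thesis by metis
qed

lemma infinite_coprime:
  assumes "N > 0"
  shows "infinite {m :: nat. 0 < m \<and> coprime m N}"
proof -
  have "\<exists>m>k. m \<in> {m. 0 < m \<and> coprime m N}" for k
  proof -
    \<comment> \<open>The number \<open>k * N + 1\<close> is a witness beyond
      \<open>k\<close>.\<close>
    have "coprime (Suc (k * N)) N"
      by (metis coprime_commute coprime_mult_left_iff coprime_Suc_right_nat mult.commute coprime_Suc_left_nat)
    moreover have "Suc (k * N) > k" using assms by (simp add: less_Suc_eq_le)
    ultimately show ?thesis by blast
  qed
  then show ?thesis by (simp add: infinite_nat_iff_unbounded)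
qed

text \<open>Each gap is identified with its left endpoint, and the left endpoints over one period
  are exactly the totatives of \<open>N\<close>.\<close>

lemma gap_count_eq:
  assumes N: "N > 1" and g: "g > 0"
  shows "gap_count g N = card (pattern {0, g} N - (\<Union>j\<in>{0<..<g}. pattern {0, j, g} N))"
proof -
  let ?S = "{m :: nat. 0 < m \<and> coprime m N}"
  let ?e = "enumerate ?S"
  let ?G = "\<lambda>a. coprime (a + g) N \<and> (\<forall>j\<in>{0<..<g}. \<not> coprime (a + j) N)"
  have S: "infinite ?S" using N by (intro infinite_coprime) auto
  have tot: "{k \<in> ?S. k \<le> N} = totatives N"
    by (auto simp: totatives_def)
  have img: "?e ` {..<totient N} = totatives N"
    using enumerate_image_initial_segment[OF S, of N] by (simp only: tot totient_def)
  have inj: "inj ?e" using inj_enumerate[OF S] .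
  have gap: "gap N (Suc i) = g \<longleftrightarrow> ?G (?e i)" for i
    using enumerate_diff_eq_iff[OF S g, of i] g by (auto simp: gap_def coprime_seq_def)
  \<comment> \<open>Gaps are indexed from \<open>1\<close>, the enumeration from
    \<open>0\<close>.\<close>
  have "{i \<in> {1..totient N}. gap N i = g} = Suc ` {i \<in> {..<totient N}. ?G (?e i)}"
  proof (intro equalityI subsetI)
    fix i assume "i \<in> {i \<in> {1..totient N}. gap N i = g}"
    then show "i \<in> Suc ` {i \<in> {..<totient N}. ?G (?e i)}"
      using gap by (cases i) auto
  next
    fix i assume "i \<in> Suc ` {i \<in> {..<totient N}. ?G (?e i)}"
    then obtain k where k: "i = Suc k" "k < totient N" "?G (?e k)" by auto
    have "gap N (Suc k) = g" using k(3) gap by blast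
    then show "i \<in> {i \<in> {1..totient N}. gap N i = g}"
      using k(1,2) by auto
  qed
  then have "gap_count g N = card {i \<in> {..<totient N}. ?G (?e i)}"
    by (simp only: gap_count_def card_image inj_Suc)
  also have "\<dots> = card (?e ` {i \<in> {..<totient N}. ?G (?e i)})"
    by (rule card_image[symmetric]) (rule inj_on_subset[OF inj], simp)
  also have "?e ` {i \<in> {..<totient N}. ?G (?e i)} = {a \<in> totatives N. ?G a}"
    unfolding img[symmetric] by blast
  also have "\<dots> = pattern {0, g} N - (\<Union>j\<in>{0<..<g}. pattern {0, j, g} N)"
  proof -
    \<comment> \<open>Totatives range over \<open>1\<close> to \<open>N\<close>, patterns over
      \<open>0\<close> to \<open>N - 1\<close>. As \<open>N > 1\<close>, neither \<open>0\<close>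
      nor \<open>N\<close> is coprime to \<open>N\<close>.\<close>
    have "a \<in> totatives N \<longleftrightarrow> a < N \<and> coprime a N" for a
    proof (cases "a = 0 \<or> a = N")
      case True
      then show ?thesis using N by (auto simp: totatives_def)
    next
      case False
      then show ?thesis by (auto simp: totatives_def)
    qed
    then show ?thesis by (auto simp: pattern_def)
  qed
  finally show ?thesis .
qed


section \<open>Vanishing of the Euler product over the primes\<close>

text \<open>The cutoff \<open>x\<close> replaces the infinite series of Euler's product by a finite
  sum.\<close>

definition smooth :: "nat set \<Rightarrow> nat \<Rightarrow> nat set" where
  "smooth S x = {m \<in> {1..x}. \<forall>q. prime q \<and> q dvd m \<longrightarrow> q \<in> S}"

lemma finite_smooth [simp]: "finite (smooth S x)"
  by (simp add: smooth_def)

text \<open>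
  A truncated Euler product: in the induction step, an element of \<open>smooth (insert q S) x\<close> is either
  in \<open>smooth S x\<close> or \<open>q\<close> times an element of \<open>smooth (insert q S) x\<close>.
\<close>

lemma sum_smooth_times_prod_le_1:
  assumes "finite S" "\<And>q. q \<in> S \<Longrightarrow> prime q"
  shows "(\<Sum>m\<in>smooth S x. 1 / real m) * (\<Prod>q\<in>S. 1 - 1 / real q) \<le> 1"
  using assms
proof (induction S rule: finite_induct)
  case empty
  have "smooth {} x \<subseteq> {1}"
    using prime_factor_nat by (auto simp: smooth_def)
  then have "(\<Sum>m\<in>smooth {} x. 1 / real m) \<le> (\<Sum>m\<in>{1}. 1 / real m)"
    by (intro sum_mono2) auto
  then show ?case by simp
next
  case (insert q S)
  let ?T = "smooth (insert q S) x"
  have q: "prime q" using insert by simp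
  then have q1: "q > 1" by (rule prime_gt_1_nat)
  \<comment> \<open>Only an inclusion, since \<open>q * m\<close> may exceed \<open>x\<close>; an
    upper bound is all that is wanted.\<close>
  have "?T \<subseteq> smooth S x \<union> (\<lambda>m. q * m) ` ?T"
  proof
    fix m assume m: "m \<in> ?T"
    show "m \<in> smooth S x \<union> (\<lambda>m. q * m) ` ?T"
    proof (cases "q dvd m")
      case True
      then obtain k where k: "m = q * k" by (elim dvdE)
      have "k \<le> m" "k \<ge> 1" using k m q1 by (auto simp: smooth_def)
      moreover have "k \<le> x" using \<open>k \<le> m\<close> m by (simp add: smooth_def)
      ultimately have "k \<in> ?T" using m k by (auto simp: smooth_def)
      then show ?thesis using k by blast
    next
      case False
      then show ?thesis using m by (auto simp: smooth_def)
    qed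
  qed
  then have "(\<Sum>m\<in>?T. 1 / real m) \<le> (\<Sum>m\<in>smooth S x \<union> (\<lambda>m. q * m) ` ?T. 1 / real m)"
    by (intro sum_mono2) auto
  also have "\<dots> \<le> (\<Sum>m\<in>smooth S x. 1 / real m) + (\<Sum>m\<in>(\<lambda>m. q * m) ` ?T. 1 / real m)"
    by (subst sum.union_inter[symmetric]) (auto intro!: sum_nonneg)
  also have "(\<Sum>m\<in>(\<lambda>m. q * m) ` ?T. 1 / real m) = (\<Sum>m\<in>?T. 1 / real m) / real q"
    using q1 by (subst sum.reindex) (auto simp: inj_on_def sum_divide_distrib mult.commute)
  finally have "(\<Sum>m\<in>?T. 1 / real m) * (1 - 1 / real q) \<le> (\<Sum>m\<in>smooth S x. 1 / real m)"
    by (simp add: algebra_simps)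
  moreover have "(\<Prod>q\<in>S. 1 - 1 / real q) \<ge> 0"
    by (intro prod_nonneg) (auto simp: divide_le_eq_1 Suc_le_eq)
  ultimately have "(\<Sum>m\<in>?T. 1 / real m) * (1 - 1 / real q) * (\<Prod>q\<in>S. 1 - 1 / real q)
      \<le> (\<Sum>m\<in>smooth S x. 1 / real m) * (\<Prod>q\<in>S. 1 - 1 / real q)"
    by (rule mult_right_mono)
  also have "\<dots> \<le> 1"
    using insert by simp
  finally show ?case
    using insert.hyps by (simp add: mult.assoc)
qed

text \<open>All prime factors of a number in \<open>{1..p}\<close> are at most \<open>p\<close>, so
  the smooth sum is the whole harmonic sum, whose divergence then forces the product to
  \<open>0\<close>.\<close>

lemma harm_times_prime_prod_le_1:
  "harm p * (\<Prod>q | prime q \<and> q \<le> p. 1 - 1 / real q) \<le> 1"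
proof -
  have "smooth {q. prime q \<and> q \<le> p} p = {1..p}"
    by (auto simp: smooth_def dest: dvd_imp_le)
  then have "harm p = (\<Sum>m\<in>smooth {q. prime q \<and> q \<le> p} p. 1 / real m)"
    by (simp only: harm_def inverse_eq_divide)
  then show ?thesis
    by (simp only:) (rule sum_smooth_times_prod_le_1, auto)
qed

lemma prime_prod_tendsto_0:
  "(\<lambda>p. \<Prod>q | prime q \<and> q \<le> p. 1 - 1 / real q) \<longlonglongrightarrow> 0"
proof (rule tendsto_sandwich)
  show "\<forall>\<^sub>F p in sequentially. 0 \<le> (\<Prod>q | prime q \<and> q \<le> p. 1 - 1 / real q)"
    by (intro always_eventually allI prod_nonneg) (auto simp: divide_le_eq_1 Suc_le_eq)
  show "\<forall>\<^sub>F p in sequentially. (\<Prod>q | prime q \<and> q \<le> p. 1 - 1 / real q) \<le> inverse (harm p)"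
    using eventually_gt_at_top[of 0]
  proof eventually_elim
    case (elim p)
    then have "harm p > (0 :: real)" by (rule harm_pos)
    then show ?case
      using harm_times_prime_prod_le_1[of p] by (simp add: field_simps)
  qed
  show "(\<lambda>p. inverse (harm p :: real)) \<longlonglongrightarrow> 0"
    by (rule tendsto_inverse_0_at_top[OF harm_at_top])
qed simp

text \<open>The finitely many factors up to \<open>M\<close>, where no comparison is assumed, only
  contribute a constant.\<close>

lemma prime_prod_tendsto_0_comparison:
  fixes f :: "nat \<Rightarrow> real"
  assumes nonneg: "\<And>q. prime q \<Longrightarrow> f q \<ge> 0"
    and le: "\<And>q. prime q \<Longrightarrow> q > M \<Longrightarrow> f q \<le> 1 - 1 / real q"
  shows "(\<lambda>p. \<Prod>q | prime q \<and> q \<le> p. f q) \<longlonglongrightarrow> 0"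
proof (rule tendsto_sandwich)
  let ?e = "\<lambda>q. 1 - 1 / real q"
  \<comment> \<open>\<open>C\<close> exchanges the factors of \<open>?e\<close> up to
    \<open>M\<close> for those of \<open>f\<close>.\<close>
  define C where "C = (\<Prod>q | prime q \<and> q \<le> M. f q) / (\<Prod>q | prime q \<and> q \<le> M. ?e q)"
  show "\<forall>\<^sub>F p in sequentially. 0 \<le> (\<Prod>q | prime q \<and> q \<le> p. f q)"
    by (intro always_eventually allI prod_nonneg) (auto intro: nonneg)
  show "\<forall>\<^sub>F p in sequentially.
      (\<Prod>q | prime q \<and> q \<le> p. f q) \<le> C * (\<Prod>q | prime q \<and> q \<le> p. ?e q)"
    using eventually_ge_at_top[of M]
  proof eventually_elim
    case (elim p)
    have split: "{q. prime q \<and> q \<le> p} = {q. prime q \<and> q \<le> M} \<union> {q. prime q \<and> M < q \<and> q \<le> p}"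
      using elim by auto
    have prod_split: "(\<Prod>q | prime q \<and> q \<le> p. g q) =
        (\<Prod>q | prime q \<and> q \<le> M. g q) * (\<Prod>q | prime q \<and> M < q \<and> q \<le> p. g q)"
      for g :: "nat \<Rightarrow> real"
      unfolding split by (rule prod.union_disjoint) auto
    have "?e q > 0" if "prime q" for q
      using prime_gt_1_nat[OF that] by simp
    then have pos: "(\<Prod>q | prime q \<and> q \<le> M. ?e q) > 0"
      by (intro prod_pos) auto
    have "(\<Prod>q | prime q \<and> q \<le> p. f q) \<le>
        (\<Prod>q | prime q \<and> q \<le> M. f q) * (\<Prod>q | prime q \<and> M < q \<and> q \<le> p. ?e q)"
      unfolding prod_split[of f]
      by (intro mult_left_mono prod_mono prod_nonneg) (auto intro: nonneg le)
    also have "\<dots> = C * (\<Prod>q | prime q \<and> q \<le> p. ?e q)"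
      unfolding prod_split[of ?e] C_def using pos by simp
    finally show ?case .
  qed
  show "(\<lambda>p. C * (\<Prod>q | prime q \<and> q \<le> p. ?e q)) \<longlonglongrightarrow> 0"
    using tendsto_mult_right_zero[OF prime_prod_tendsto_0] .
qed simp

section \<open>Ratios of pattern counts\<close>

lemma card_residues_pair:
  fixes q k :: nat
  shows "card ((\<lambda>h. h mod q) ` {0, k}) = (if q dvd k then 1 else 2)"
proof (cases "q dvd k")
  case True
  then show ?thesis by (simp add: dvd_eq_mod_eq_0)
next
  case False
  then have "0 \<noteq> k mod q" by (simp add: dvd_eq_mod_eq_0)
  then show ?thesis using False by simp
qed

lemma card_residues_triple:
  fixes j k q :: nat
  assumes "0 < j" "j < k" "k < q"
  shows "card ((\<lambda>h. h mod q) ` {0, j, k}) = 3"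
  using assms by simp

text \<open>The factors at \<open>2\<close> and at primes not dividing \<open>n\<close> cancel. With
  \<open>p \<ge> n\<close> every prime divisor of \<open>n\<close> is already present, so the ratio
  equals its limit exactly.\<close>

lemma card_pattern_pair_ratio:
  assumes "p \<ge> n" "n > 0"
  shows "real (card (pattern {0, 2 * n} (primorial p))) / real (card (pattern {0, 2} (primorial p)))
    = (\<Prod>q | prime q \<and> q > 2 \<and> q dvd n. (real q - 1) / (real q - 2))"
proof -
  let ?\<nu> = "\<lambda>k q. if q dvd k then 1 else 2 :: nat"
  have dvd2: "q dvd 2 \<longleftrightarrow> q = 2" "q dvd 2 * n \<longleftrightarrow> q = 2 \<or> q dvd n" "q \<ge> 2" if "prime q" for q :: nat
    using that by (auto simp: prime_dvd_mult_iff primes_dvd_imp_eq prime_ge_2_nat)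
  have "real (card (pattern {0, 2 * n} (primorial p))) / real (card (pattern {0, 2} (primorial p)))
    = (\<Prod>q | prime q \<and> q \<le> p. real (q - ?\<nu> (2 * n) q) / real (q - ?\<nu> 2 q))"
    unfolding card_pattern_primorial card_residues_pair by (simp add: prod_dividef)
  also have "\<dots> = (\<Prod>q | prime q \<and> q > 2 \<and> q dvd n. (real q - 1) / (real q - 2))"
  proof (rule prod.mono_neutral_cong_right)
    show "finite {q. prime q \<and> q \<le> p}" by simp
    show "{q. prime q \<and> 2 < q \<and> q dvd n} \<subseteq> {q. prime q \<and> q \<le> p}"
      using assms by (auto dest!: dvd_imp_le)
    show "\<forall>q\<in>{q. prime q \<and> q \<le> p} - {q. prime q \<and> 2 < q \<and> q dvd n}.
        real (q - ?\<nu> (2 * n) q) / real (q - ?\<nu> 2 q) = 1"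
    proof
      fix q assume "q \<in> {q. prime q \<and> q \<le> p} - {q. prime q \<and> 2 < q \<and> q dvd n}"
      then have q: "prime q" "\<not> (q > 2 \<and> q dvd n)" by auto
      show "real (q - ?\<nu> (2 * n) q) / real (q - ?\<nu> 2 q) = 1"
        using q dvd2[OF q(1)] by (cases "q = 2") auto
    qed
    show "real (q - ?\<nu> (2 * n) q) / real (q - ?\<nu> 2 q) = (real q - 1) / (real q - 2)"
      if "q \<in> {q. prime q \<and> 2 < q \<and> q dvd n}" for q
      using that dvd2[of q] by (auto simp: of_nat_diff)
  qed
  finally show ?thesis .
qed

text \<open>For primes \<open>q > k\<close> the factor is
  \<open>(q - 3) / (q - 2) = 1 - 1 / (q - 2)\<close>, which is at most
  \<open>1 - 1 / q\<close>.\<close>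

lemma card_pattern_triple_ratio_tendsto_0:
  assumes "0 < j" "j < k" "k \<ge> 2"
  shows "(\<lambda>p. real (card (pattern {0, j, k} (primorial p))) /
              real (card (pattern {0, 2} (primorial p)))) \<longlonglongrightarrow> 0"
proof -
  define f where "f q = real (q - card ((\<lambda>h. h mod q) ` {0, j, k})) /
    real (q - card ((\<lambda>h. h mod q) ` {0, 2}))" for q :: nat
  have "(\<lambda>p. \<Prod>q | prime q \<and> q \<le> p. f q) \<longlonglongrightarrow> 0"
  proof (rule prime_prod_tendsto_0_comparison)
    show "f q \<ge> 0" for q by (simp add: f_def)
    fix q :: nat assume q: "prime q" "q > k"
    have q3: "q \<ge> 3" using q assms by simp
    then have "\<not> q dvd 2" by (auto dest: dvd_imp_le)
    then have "f q = (real q - 3) / (real q - 2)"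
      using assms q q3 unfolding f_def card_residues_pair
      by (subst card_residues_triple) (auto simp: of_nat_diff)
    also have "\<dots> \<le> 1 - 1 / real q"
      using q3 by (simp add: field_simps)
    finally show "f q \<le> 1 - 1 / real q" .
  qed
  then show ?thesis
    unfolding card_pattern_primorial f_def by (simp add: prod_dividef)
qed

section \<open>Gap counts and the limit of their ratio\<close>

text \<open>Of two consecutive integers one is even, so nothing has to be discarded when
  \<open>N\<close> is even.\<close>

lemma gap_count_2_eq:
  assumes "N > 1" "even N"
  shows "gap_count 2 N = card (pattern {0, 2} N)"
proof -
  have "{0<..<2} = {1 :: nat}" by auto
  moreover have "\<not> (coprime a N \<and> coprime (a + 1) N)" for a
    using assms(2) coprime_common_divisor[of a N 2] coprime_common_divisor[of "a + 1" N 2] by auto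
  then have "pattern {0, 1, 2} N = {}"
    by (auto simp: pattern_def)
  ultimately show ?thesis
    using gap_count_eq[of N 2] assms(1) by simp
qed

text \<open>A union bound over the possible intermediate elements \<open>a + j\<close>.\<close>

lemma gap_count_bounds:
  assumes "N > 1" "g > 0"
  shows "gap_count g N \<le> card (pattern {0, g} N)"
    and "card (pattern {0, g} N) \<le> gap_count g N + (\<Sum>j\<in>{0<..<g}. card (pattern {0, j, g} N))"
proof -
  let ?U = "\<Union>j\<in>{0<..<g}. pattern {0, j, g} N"
  show "gap_count g N \<le> card (pattern {0, g} N)"
    unfolding gap_count_eq[OF assms] by (intro card_mono) auto
  have "card (pattern {0, g} N) \<le> card ((pattern {0, g} N - ?U) \<union> ?U)"
    by (intro card_mono) auto
  also have "\<dots> \<le> card (pattern {0, g} N - ?U) + card ?U"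
    by (rule card_Un_le)
  also have "card ?U \<le> (\<Sum>j\<in>{0<..<g}. card (pattern {0, j, g} N))"
    by (intro card_UN_le) simp
  finally show "card (pattern {0, g} N) \<le> gap_count g N + (\<Sum>j\<in>{0<..<g}. card (pattern {0, j, g} N))"
    unfolding gap_count_eq[OF assms] by simp
qed

text \<open>A sandwich between the pair ratio and the pair ratio minus the negligible triple ratios.
  The limit is taken over all natural \<open>p\<close>; the restriction to primes comes
  afterwards.\<close>

lemma gap_ratio_tendsto:
  assumes n: "n > 0"
  shows "(\<lambda>p. gap_ratio (2 * n) (primorial p)) \<longlonglongrightarrow>
    (\<Prod>q | prime q \<and> q > 2 \<and> q dvd n. (real q - 1) / (real q - 2))"
    (is "_ \<longlonglongrightarrow> ?L")
proof -
  let ?c = "\<lambda>H p. real (card (pattern H (primorial p)))"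
  let ?E = "\<lambda>p. \<Sum>j\<in>{0<..<2 * n}. ?c {0, j, 2 * n} p / ?c {0, 2} p"
  have main: "(\<lambda>p. ?c {0, 2 * n} p / ?c {0, 2} p) \<longlonglongrightarrow> ?L"
    using card_pattern_pair_ratio[OF _ n]
    by (intro tendsto_eventually eventually_sequentiallyI[of n])
  have "?E \<longlonglongrightarrow> 0"
    using n by (intro tendsto_null_sum card_pattern_triple_ratio_tendsto_0) auto
  from tendsto_diff[OF main this]
  have lower: "(\<lambda>p. ?c {0, 2 * n} p / ?c {0, 2} p - ?E p) \<longlonglongrightarrow> ?L"
    by simp
  have bounds: "gap_ratio (2 * n) (primorial p) \<le> ?c {0, 2 * n} p / ?c {0, 2} p"
    "?c {0, 2 * n} p / ?c {0, 2} p - ?E p \<le> gap_ratio (2 * n) (primorial p)" if "p \<ge> 2" for p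
  proof -
    note N = primorial_gt_1[OF that]
    have g: "2 * n > 0" using n by simp
    have eq: "gap_ratio (2 * n) (primorial p) = real (gap_count (2 * n) (primorial p)) / ?c {0, 2} p"
      unfolding gap_ratio_def gap_count_2_eq[OF N even_primorial[OF that]] ..
    show "gap_ratio (2 * n) (primorial p) \<le> ?c {0, 2 * n} p / ?c {0, 2} p"
      unfolding eq using gap_count_bounds(1)[OF N g] by (intro divide_right_mono) auto
    have "?c {0, 2 * n} p \<le> real (gap_count (2 * n) (primorial p) +
        (\<Sum>j\<in>{0<..<2 * n}. card (pattern {0, j, 2 * n} (primorial p))))"
      using gap_count_bounds(2)[OF N g] by (intro of_nat_mono)
    then have "?c {0, 2 * n} p - (\<Sum>j\<in>{0<..<2 * n}. ?c {0, j, 2 * n} p)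
        \<le> real (gap_count (2 * n) (primorial p))"
      by simp
    then have "(?c {0, 2 * n} p - (\<Sum>j\<in>{0<..<2 * n}. ?c {0, j, 2 * n} p)) / ?c {0, 2} p
        \<le> gap_ratio (2 * n) (primorial p)"
      unfolding eq by (rule divide_right_mono) simp
    then show "?c {0, 2 * n} p / ?c {0, 2} p - ?E p \<le> gap_ratio (2 * n) (primorial p)"
      by (simp add: diff_divide_distrib sum_divide_distrib)
  qed
  show ?thesis
    by (rule tendsto_sandwich[OF _ _ lower main])
      (rule eventually_sequentiallyI[of 2], erule bounds)+
qed

theorem theorem3p1:
  fixes n :: nat
  assumes "n > 0"
  shows "infinite {p :: nat. prime p \<and> 2 * n \<in> set (gap_cycle (primorial p))}
    \<and> ((\<lambda>p. gap_ratio (2 * n) (primorial p)) \<longlongrightarrow>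
          (\<Prod>q \<in> {q :: nat. prime q \<and> q > 2 \<and> q dvd n}. (real q - 1) / (real q - 2)))
        primes_at_top"
proof
  let ?L = "\<Prod>q | prime q \<and> q > 2 \<and> q dvd n. (real q - 1) / (real q - 2)"
  note lim = gap_ratio_tendsto[OF assms]
  \<comment> \<open>Every factor is positive because \<open>q > 2\<close>.\<close>
  have "?L > 0"
    by (intro prod_pos) (simp add: divide_pos_pos)
  then have "\<forall>\<^sub>F p in sequentially. gap_ratio (2 * n) (primorial p) > 0"
    by (rule order_tendstoD(1)[OF lim])
  then obtain P where P: "\<And>p. p \<ge> P \<Longrightarrow> gap_ratio (2 * n) (primorial p) > 0"
    by (auto simp: eventually_sequentially)
  have mem: "2 * n \<in> set (gap_cycle (primorial p))" if "p \<ge> P" for p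
  proof -
    \<comment> \<open>A zero numerator would make the ratio \<open>0\<close>, whatever the
      denominator.\<close>
    have "gap_count (2 * n) (primorial p) \<noteq> 0"
      using P[OF that] by (intro notI) (simp add: gap_ratio_def)
    then have "{i \<in> {1..totient (primorial p)}. gap (primorial p) i = 2 * n} \<noteq> {}"
      unfolding gap_count_def by (metis card.empty)
    then obtain i where i: "i \<in> {1..totient (primorial p)}" "gap (primorial p) i = 2 * n"
      by blast
    then have "i \<in> {1..<totient (primorial p) + 1}"
      by simp
    then show ?thesis
      unfolding gap_cycle_def set_map set_upt i(2)[symmetric] by (rule imageI)
  qed
  show "infinite {p :: nat. prime p \<and> 2 * n \<in> set (gap_cycle (primorial p))}"
    unfolding infinite_nat_iff_unbounded
  proof
    fix m
    obtain p where "prime p" "p > max m P"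
      using bigger_prime by blast
    then show "\<exists>p>m. p \<in> {p. prime p \<and> 2 * n \<in> set (gap_cycle (primorial p))}"
      using mem by (intro exI[of _ p]) auto
  qed
  show "((\<lambda>p. gap_ratio (2 * n) (primorial p)) \<longlongrightarrow> ?L) primes_at_top"
    \<comment> \<open>\<open>primes_at_top\<close> is finer than \<open>at_top\<close>, so the limit
      is inherited.\<close>
    unfolding primes_at_top_def by (rule tendsto_mono[OF inf_le1 lim])
qed

end
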